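(* Let $(\boldsymbol m,\boldsymbol u)$ and $(\tilde{\boldsymbol m},\tilde{\boldsymbol u})$ be two solutions on $[0,\infty)$ of the flow $$\begin{bmatrix}\dot{\boldsymbol m}\\ \dot{\boldsymbol u}\end{bmatrix}=-A\begin{bmatrix}\boldsymbol m\\ \boldsymbol u\end{bmatrix}+\begin{bmatrix}\overline H(t)\\ 0\end{bmatrix},$$ where, for each solution, the real number $\overline H(t)$ is chosen (depending on the solution) so that $\frac{d}{dt}\int_{\mathbb T}\boldsymbol m(t)\,dx=0$. Assume that $(\boldsymbol m(t),\boldsymbol u(t))\in D(A)$ and $(\tilde{\boldsymbol m}(t),\tilde{\boldsymbol u}(t))\in D(A)$ for all $t\ge 0$, and that $\int_{\mathbb T}\boldsymbol m(0)\,dx=1$ and $\int_{\mathbb T}\tilde{\boldsymbol m}(0)\,dx=1$. Then $$\frac{d}{dt}\Big(\|\boldsymbol u-\tilde{\boldsymbol u}\|_{L^2(\mathbb T)}^2+\|\boldsymbol m-\tilde{\boldsymbol m}\|_{L^2(\mathbb T)}^2\Big)\le 0 .$$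
   Context: $\mathbb T=\mathbb R/\mathbb Z$ is the one-dimensional torus, and $V,b:\mathbb T\to\mathbb R$ are given $C^\infty$ functions. The operator $A$ on $L^2(\mathbb T)\times L^2(\mathbb T)$ has domain $$D(A)=\{(m,u)\in W^{1,2}(\mathbb T)\times W^{2,2}(\mathbb T):\ \inf_{\mathbb T}m>0\}$$ and is given by $$A\begin{bmatrix}m\\ u\end{bmatrix}=\begin{bmatrix}-\frac{u_x^2}{2}-V(x)-b(x)u_x+\ln m\\ -(m(u_x+b(x)))_x\end{bmatrix}.$$ A solution of the flow is a curve $t\mapsto(\boldsymbol m(t),\boldsymbol u(t))$, differentiable as a map from $[0,\infty)$ to $L^2(\mathbb T)\times L^2(\mathbb T)$, with values in $D(A)$ and satisfying the equation for every $t\ge0$. The dot denotes the derivative in $t$. *)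

theory Defs
  imports "HOL-Probability.Probability"
begin

text \<open>
  Functions on the torus \<open>\<real>/\<int>\<close> are 1-periodic functions on the reals. Their integrals
  are taken over the fundamental domain \<open>[0,1]\<close>; counting the endpoint twice is harmless, as it
  is a null set. Elements of Lebesgue and Sobolev spaces are represented by functions, and equality
  in these spaces is equality almost everywhere.
\<close>

definition torus :: "real measure" where
  "torus = lebesgue_on {0..1}"

definition periodic :: "(real \<Rightarrow> real) \<Rightarrow> bool" where
  "periodic f \<longleftrightarrow> (\<forall>x. f (x + 1) = f x)"

definition torus_smooth :: "(real \<Rightarrow> real) \<Rightarrow> bool" where
  "torus_smooth f \<longleftrightarrow> periodic f \<and> (\<forall>k. (deriv ^^ k) f differentiable_on UNIV)"

definition L2 :: "(real \<Rightarrow> real) set" where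
  "L2 = {f. periodic f \<and> f \<in> borel_measurable torus \<and> integrable torus (\<lambda>x. (f x)\<^sup>2)}"

definition L2_norm :: "(real \<Rightarrow> real) \<Rightarrow> real" where
  "L2_norm f = sqrt (\<integral>x. (f x)\<^sup>2 \<partial>torus)"

definition has_weak_deriv :: "(real \<Rightarrow> real) \<Rightarrow> (real \<Rightarrow> real) \<Rightarrow> bool" where
  "has_weak_deriv f g \<longleftrightarrow> f \<in> L2 \<and> g \<in> L2 \<and>
     (\<forall>\<phi>. torus_smooth \<phi> \<longrightarrow>
        (\<integral>x. f x * deriv \<phi> x \<partial>torus) = - (\<integral>x. g x * \<phi> x \<partial>torus))"

text \<open>A weak derivative is determined only up to null sets; this selects a representative.\<close>

definition weak_deriv :: "(real \<Rightarrow> real) \<Rightarrow> real \<Rightarrow> real" where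
  "weak_deriv f = (SOME g. has_weak_deriv f g)"

text \<open>\<open>sobolev k\<close> is \<open>W\<^sup>k\<^sup>,\<^sup>2\<close> of the torus.\<close>

primrec sobolev :: "nat \<Rightarrow> (real \<Rightarrow> real) set" where
  "sobolev 0 = L2"
| "sobolev (Suc k) = {f \<in> L2. \<exists>g \<in> sobolev k. has_weak_deriv f g}"

text \<open>
  The infimum of a Sobolev function must not depend on its values on null sets. For the continuous
  representative of an element of \<open>W\<^sup>1\<^sup>,\<^sup>2\<close> it is the ordinary infimum.
\<close>

definition torus_inf :: "(real \<Rightarrow> real) \<Rightarrow> ereal" where
  "torus_inf f = - esssup torus (\<lambda>x. - ereal (f x))"

definition dom_A :: "((real \<Rightarrow> real) \<times> (real \<Rightarrow> real)) set" where
  "dom_A = {(m, u). m \<in> sobolev 1 \<and> u \<in> sobolev 2 \<and> torus_inf m > 0}"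

definition op_A ::
  "(real \<Rightarrow> real) \<Rightarrow> (real \<Rightarrow> real) \<Rightarrow> (real \<Rightarrow> real) \<times> (real \<Rightarrow> real)
    \<Rightarrow> (real \<Rightarrow> real) \<times> (real \<Rightarrow> real)" where
  "op_A V b = (\<lambda>(m, u).
     (\<lambda>x. - (weak_deriv u x)\<^sup>2 / 2 - V x - b x * weak_deriv u x + ln (m x),
      \<lambda>x. - weak_deriv (\<lambda>y. m y * (weak_deriv u y + b y)) x))"

text \<open>
  The derivative at time \<open>t\<close> of a curve \<open>[0,\<infinity>) \<rightarrow> L\<^sup>2\<close>; at \<open>t = 0\<close> it is one-sided.
\<close>

definition has_L2_deriv ::
  "(real \<Rightarrow> real \<Rightarrow> real) \<Rightarrow> (real \<Rightarrow> real) \<Rightarrow> real \<Rightarrow> bool" where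
  "has_L2_deriv f g t \<longleftrightarrow> g \<in> L2 \<and>
     ((\<lambda>s. L2_norm (\<lambda>x. (f s x - f t x) / (s - t) - g x)) \<longlongrightarrow> 0) (at t within {0..})"

text \<open>
  \<open>flow_solution V b H m u\<close>: the curve \<open>(m, u)\<close> solves the flow on \<open>[0,\<infinity>)\<close>, and \<open>H\<close> keeps the
  total mass of \<open>m\<close> constant.
\<close>

definition flow_solution ::
  "(real \<Rightarrow> real) \<Rightarrow> (real \<Rightarrow> real) \<Rightarrow> (real \<Rightarrow> real) \<Rightarrow>
    (real \<Rightarrow> real \<Rightarrow> real) \<Rightarrow> (real \<Rightarrow> real \<Rightarrow> real) \<Rightarrow> bool" where
  "flow_solution V b H m u \<longleftrightarrow>
     (\<forall>t\<ge>0. (m t, u t) \<in> dom_A) \<and>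
     (\<forall>t\<ge>0. \<exists>dm du. has_L2_deriv m dm t \<and> has_L2_deriv u du t \<and>
        (AE x in torus. dm x = - fst (op_A V b (m t, u t)) x + H t) \<and>
        (AE x in torus. du x = - snd (op_A V b (m t, u t)) x)) \<and>
     (\<forall>t\<ge>0. ((\<lambda>s. \<integral>x. m s x \<partial>torus) has_real_derivative 0) (at t within {0..}))"

end

theory Submission
  imports Defs "HOL-Complex_Analysis.Cauchy_Integral_Formula"
begin

text \<open>
  The squared distance decreases because \<open>A\<close> is a monotone operator. Let \<open>\<mu> = m - m'\<close>,
  \<open>\<omega> = u - u'\<close>, let \<open>p = u\<^sub>x\<close>, \<open>p' = u'\<^sub>x\<close>, and put \<open>q = p + b\<close>, \<open>q' = p' + b\<close>. The squared
  norm of a differentiable curve in \<open>L\<^sup>2\<close> is differentiable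
  (\<open>L2_norm_sq_has_real_derivative\<close>), so half the derivative in question is
  \<open>\<langle>\<omega>, \<omega>\<^sub>t\<rangle> + \<langle>\<mu>, \<mu>\<^sub>t\<rangle>\<close>. The equation for \<open>u\<close> and an integration by parts turn the first
  term into \<open>- \<integral>(q - q') (m q - m' q')\<close>. In the second term the potential \<open>V\<close> cancels, and the
  constants \<open>H t\<close> and \<open>H' t\<close> drop out because \<open>\<mu>\<close> has mean zero; what remains is
  \<open>\<integral>\<mu> (q\<^sup>2 - q'\<^sup>2) / 2 - \<integral>\<mu> (ln m - ln m')\<close>. The sum is
  \<open>- \<integral>(q - q')\<^sup>2 (m + m') / 2 - \<integral>(m - m') (ln m - ln m')\<close>, and both integrands are nonnegative
  for positive \<open>m\<close> and \<open>m'\<close> (\<open>monotone_integrand\<close>).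

  The integration by parts concerns functions that are differentiable in the weak sense only, and
  weak derivatives are tested against smooth periodic functions. The work is therefore the
  one-dimensional Sobolev calculus on the torus. Its centre is \<open>has_weak_deriv_iff_primitive\<close>: a
  function has a weak derivative iff it agrees almost everywhere with a periodic primitive of it.
  This rests on the fundamental lemma \<open>AE_eq_0_if_orthogonal_to_smooth\<close>, for which explicit entire
  test functions approximate the indicators of initial segments. The product rule for primitives
  (\<open>primitive_mult\<close>) is Fubini's theorem on a triangle; it yields the product rule for weak
  derivatives, which shows that the flux \<open>m (u\<^sub>x + b)\<close> really has one, and integration by parts
  (\<open>has_weak_deriv_by_parts\<close>).
\<close>

section \<open>Square integrable functions on the torus\<close>

interpretation torus: finite_measure torus
  unfolding torus_def by (rule finite_measure_lebesgue_on) simp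

lemma space_torus [simp]: "space torus = {0..1}"
  by (simp add: torus_def)

lemma borel_measurable_torus: "f \<in> borel_measurable borel \<Longrightarrow> f \<in> borel_measurable torus"
  unfolding torus_def by (intro measurable_restrict_space1 measurable_completion) simp

lemma measure_torus [simp]: "measure torus {0..1} = 1"
  by (simp add: torus_def measure_restrict_space)

lemma AE_torus_neq: "AE x in torus. x \<noteq> a"
proof -
  have "AE x in lebesgue. x \<notin> {a}"
    by (intro AE_not_in) (simp add: null_sets_def)
  then show ?thesis
    unfolding torus_def by (subst AE_restrict_space_iff) auto
qed

lemma integrable_AE_bounded_mult:
  fixes f h :: "'a \<Rightarrow> real"
  assumes "integrable M f" and [measurable]: "h \<in> borel_measurable M"
    and "AE x in M. \<bar>h x\<bar> \<le> C"
  shows "integrable M (\<lambda>x. h x * f x)"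
proof (rule Bochner_Integration.integrable_bound)
  show "integrable M (\<lambda>x. C * f x)"
    using assms(1) by simp
  show "(\<lambda>x. h x * f x) \<in> borel_measurable M"
    using borel_measurable_integrable[OF assms(1)] by measurable
  show "AE x in M. norm (h x * f x) \<le> norm (C * f x)"
    using assms(3)
  proof eventually_elim
    case (elim x)
    then have "\<bar>h x\<bar> * \<bar>f x\<bar> \<le> \<bar>C\<bar> * \<bar>f x\<bar>"
      by (intro mult_right_mono) auto
    then show ?case
      by (simp add: abs_mult)
  qed
qed

lemma
  assumes "f \<in> L2"
  shows L2_periodic: "periodic f" and L2_measurable: "f \<in> borel_measurable torus"
    and L2_integrable_square: "integrable torus (\<lambda>x. (f x)\<^sup>2)"
  using assms by (auto simp: L2_def)

lemma L2_integrable_mult: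
  assumes f: "f \<in> L2" and g: "g \<in> L2"
  shows "integrable torus (\<lambda>x. f x * g x)"
proof (rule Bochner_Integration.integrable_bound)
  show "integrable torus (\<lambda>x. (f x)\<^sup>2 + (g x)\<^sup>2)"
    using f g by (simp add: L2_integrable_square)
  show "(\<lambda>x. f x * g x) \<in> borel_measurable torus"
    using f[THEN L2_measurable] g[THEN L2_measurable] by measurable
  have "\<bar>a * b\<bar> \<le> a\<^sup>2 + b\<^sup>2" for a b :: real
    using sum_squares_bound[of "\<bar>a\<bar>" "\<bar>b\<bar>"] mult_nonneg_nonneg[of "\<bar>a\<bar>" "\<bar>b\<bar>"]
    unfolding abs_mult power2_abs by linarith
  then show "AE x in torus. norm (f x * g x) \<le> norm ((f x)\<^sup>2 + (g x)\<^sup>2)"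
    by simp
qed

lemma L2_integrable: "f \<in> L2 \<Longrightarrow> integrable torus f"
  by (rule torus.square_integrable_imp_integrable) (auto simp: L2_def)

lemma L2_add: "f \<in> L2 \<Longrightarrow> g \<in> L2 \<Longrightarrow> (\<lambda>x. f x + g x) \<in> L2"
  using L2_integrable_mult[of f g]
  by (auto simp: L2_def periodic_def power2_sum mult.assoc)

lemma L2_scale: "f \<in> L2 \<Longrightarrow> (\<lambda>x. c * f x) \<in> L2"
  by (auto simp: L2_def periodic_def power_mult_distrib)

lemma L2_diff: "f \<in> L2 \<Longrightarrow> g \<in> L2 \<Longrightarrow> (\<lambda>x. f x - g x) \<in> L2"
  using L2_add[of f "\<lambda>x. - 1 * g x"] L2_scale[of g "- 1"] by simp

lemma L2_bounded_mult:
  assumes f: "f \<in> L2" and h: "periodic h" "h \<in> borel_measurable torus"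
    and bound: "AE x in torus. \<bar>h x\<bar> \<le> C"
  shows "(\<lambda>x. h x * f x) \<in> L2"
proof -
  note [measurable] = h(2) f[THEN L2_measurable]
  have "integrable torus (\<lambda>x. (h x)\<^sup>2 * (f x)\<^sup>2)"
  proof (rule integrable_AE_bounded_mult[where C = "C\<^sup>2"])
    show "AE x in torus. \<bar>(h x)\<^sup>2\<bar> \<le> C\<^sup>2"
      using bound by eventually_elim (simp add: abs_le_square_iff[symmetric])
  qed (use f in \<open>auto simp: L2_integrable_square\<close>)
  moreover have "(\<lambda>x. h x * f x) \<in> borel_measurable torus"
    by measurable
  ultimately show ?thesis
    using f h by (auto simp: L2_def periodic_def power_mult_distrib)
qed

lemma L2_norm_nonneg: "0 \<le> L2_norm f"
  by (simp add: L2_norm_def)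

lemma L2_norm_sq: "(L2_norm f)\<^sup>2 = (\<integral>x. (f x)\<^sup>2 \<partial>torus)"
  by (simp add: L2_norm_def)

lemma L2_norm_add_scale_sq:
  assumes f: "f \<in> L2" and g: "g \<in> L2"
  shows "(L2_norm (\<lambda>x. f x + r * g x))\<^sup>2
    = (L2_norm f)\<^sup>2 + 2 * r * (\<integral>x. f x * g x \<partial>torus) + r\<^sup>2 * (L2_norm g)\<^sup>2"
proof -
  have "(L2_norm (\<lambda>x. f x + r * g x))\<^sup>2
    = (\<integral>x. (f x)\<^sup>2 + 2 * r * (f x * g x) + r\<^sup>2 * (g x)\<^sup>2 \<partial>torus)"
    by (simp add: L2_norm_sq power2_sum power_mult_distrib algebra_simps)
  also have "\<dots> = (L2_norm f)\<^sup>2 + 2 * r * (\<integral>x. f x * g x \<partial>torus) + r\<^sup>2 * (L2_norm g)\<^sup>2"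
    using L2_integrable_mult[OF f g] f g
    by (simp add: L2_norm_sq L2_integrable_square)
  finally show ?thesis .
qed

text \<open>The norm of \<open>f + r g\<close> is nonnegative for every \<open>r\<close>; the proof inserts a suitable \<open>r\<close>.\<close>

lemma L2_Cauchy_Schwarz:
  assumes f: "f \<in> L2" and g: "g \<in> L2"
  shows "\<bar>\<integral>x. f x * g x \<partial>torus\<bar> \<le> L2_norm f * L2_norm g"
proof -
  let ?a = "L2_norm f" and ?b = "L2_norm g" and ?c = "\<integral>x. f x * g x \<partial>torus"
  have pos: "0 \<le> ?a\<^sup>2 + 2 * r * ?c + r\<^sup>2 * ?b\<^sup>2" for r
    using L2_norm_add_scale_sq[OF f g, of r] by (metis zero_le_power2)
  have "?c\<^sup>2 \<le> (?a * ?b)\<^sup>2"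
  proof (cases "?b = 0")
    case True
    \<comment> \<open>The expression is affine in \<open>r\<close>, and this \<open>r\<close> makes it negative unless \<open>?c = 0\<close>.\<close>
    have "?c = 0"
      using pos[of "- (?a\<^sup>2 + 1) / (2 * ?c)"] True by (cases "?c = 0") (auto simp: field_simps)
    then show ?thesis by simp
  next
    case False
    \<comment> \<open>the minimiser of the quadratic\<close>
    then have "?c\<^sup>2 / ?b\<^sup>2 \<le> ?a\<^sup>2"
      using pos[of "- ?c / ?b\<^sup>2"] by (simp add: power2_eq_square)
    then show ?thesis
      using False by (simp add: pos_divide_le_eq power_mult_distrib)
  qed
  then show ?thesis
    by (simp add: abs_le_square_iff[symmetric] L2_norm_nonneg abs_mult)
qed

lemma L2_norm_add_scale_le:
  assumes f: "f \<in> L2" and g: "g \<in> L2"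
  shows "L2_norm (\<lambda>x. f x + r * g x) \<le> L2_norm f + \<bar>r\<bar> * L2_norm g"
proof -
  have "r * (\<integral>x. f x * g x \<partial>torus) \<le> \<bar>r\<bar> * \<bar>\<integral>x. f x * g x \<partial>torus\<bar>"
    by (metis abs_ge_self abs_mult)
  also have "\<dots> \<le> \<bar>r\<bar> * (L2_norm f * L2_norm g)"
    by (intro mult_left_mono L2_Cauchy_Schwarz f g) simp
  finally have "(L2_norm (\<lambda>x. f x + r * g x))\<^sup>2 \<le> (L2_norm f + \<bar>r\<bar> * L2_norm g)\<^sup>2"
    by (simp add: L2_norm_add_scale_sq[OF f g] power2_sum power_mult_distrib algebra_simps)
  then show ?thesis
    by (rule power2_le_imp_le) (simp add: L2_norm_nonneg)
qed

lemma eventually_quotient_in_L2: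
  assumes "\<forall>s\<ge>0. f s \<in> L2" "0 \<le> t" "g \<in> L2"
  shows "\<forall>\<^sub>F s in at t within {0..}. 0 \<le> s \<and> s \<noteq> t \<and> (\<lambda>x. (f s x - f t x) / (s - t) - g x) \<in> L2"
  unfolding eventually_at_filter
proof (intro always_eventually allI impI)
  fix s assume "s \<noteq> t" "s \<in> {0..}"
  then show "0 \<le> s \<and> s \<noteq> t \<and> (\<lambda>x. (f s x - f t x) / (s - t) - g x) \<in> L2"
    using L2_diff[OF L2_scale[OF L2_diff, of "f s" "f t" "1 / (s - t)"], of g] assms by simp
qed

lemma has_L2_deriv_diff:
  assumes f: "\<forall>s\<ge>0. f s \<in> L2" "has_L2_deriv f g t"
    and f': "\<forall>s\<ge>0. f' s \<in> L2" "has_L2_deriv f' g' t" and t: "0 \<le> t"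
  shows "has_L2_deriv (\<lambda>s x. f s x - f' s x) (\<lambda>x. g x - g' x) t"
proof -
  let ?q = "\<lambda>f g s x. (f s x - f t x) / (s - t) - g x"
  have g: "g \<in> L2" "g' \<in> L2"
    and lim: "((\<lambda>s. L2_norm (?q f g s)) \<longlongrightarrow> 0) (at t within {0..})"
      "((\<lambda>s. L2_norm (?q f' g' s)) \<longlongrightarrow> 0) (at t within {0..})"
    using f f' by (auto simp: has_L2_deriv_def)
  have "((\<lambda>s. L2_norm (?q (\<lambda>s x. f s x - f' s x) (\<lambda>x. g x - g' x) s)) \<longlongrightarrow> 0)
      (at t within {0..})"
  proof (rule Lim_null_comparison)
    show "((\<lambda>s. L2_norm (?q f g s) + L2_norm (?q f' g' s)) \<longlongrightarrow> 0) (at t within {0..})"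
      using tendsto_add[OF lim] by simp
    show "\<forall>\<^sub>F s in at t within {0..}.
        norm (L2_norm (?q (\<lambda>s x. f s x - f' s x) (\<lambda>x. g x - g' x) s))
          \<le> L2_norm (?q f g s) + L2_norm (?q f' g' s)"
      using eventually_quotient_in_L2[OF f(1) t g(1)] eventually_quotient_in_L2[OF f'(1) t g(2)]
    proof eventually_elim
      case (elim s)
      have "?q (\<lambda>s x. f s x - f' s x) (\<lambda>x. g x - g' x) s = (\<lambda>x. ?q f g s x + (- 1) * ?q f' g' s x)"
        by (auto simp: diff_divide_distrib)
      then show ?case
        using L2_norm_add_scale_le[of "?q f g s" "?q f' g' s" "- 1"] elim by (simp add: L2_norm_nonneg)
    qed
  qed
  then show ?thesis
    using L2_diff[OF g] by (simp add: has_L2_deriv_def)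
qed

text \<open>
  With \<open>e\<close> the error of the difference quotient, \<open>f s = f t + (s - t) (g + e)\<close>. Expanding the square
  shows that the difference quotient of \<open>\<parallel>f\<parallel>\<^sup>2\<close> differs from \<open>2 \<langle>f t, g\<rangle>\<close> by
  \<open>2 \<langle>f t, e\<rangle> + (s - t) \<parallel>g + e\<parallel>\<^sup>2\<close>, which tends to zero by the Cauchy--Schwarz inequality.
\<close>

lemma L2_norm_sq_has_real_derivative:
  assumes f: "\<forall>s\<ge>0. f s \<in> L2" and deriv: "has_L2_deriv f g t" and t: "0 \<le> t"
  shows "((\<lambda>s. (L2_norm (f s))\<^sup>2) has_real_derivative 2 * (\<integral>x. f t x * g x \<partial>torus))
    (at t within {0..})"
proof -
  define e where "e s x = (f s x - f t x) / (s - t) - g x" for s x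
  have g: "g \<in> L2" and lim: "((\<lambda>s. L2_norm (e s)) \<longlongrightarrow> 0) (at t within {0..})"
    using deriv by (auto simp: has_L2_deriv_def e_def[abs_def])
  have ft: "f t \<in> L2" using f t by simp
  have quotient: "(2 * d * a + d\<^sup>2 * c) / d = 2 * a + d * c" if "d \<noteq> 0" for a c d :: real
    using that by (simp add: field_simps power2_eq_square)
  let ?D = "2 * (\<integral>x. f t x * g x \<partial>torus)"
  let ?Q = "\<lambda>s. ((L2_norm (f s))\<^sup>2 - (L2_norm (f t))\<^sup>2) / (s - t)"
  let ?B = "\<lambda>s. \<bar>s - t\<bar> * (L2_norm g + L2_norm (e s))\<^sup>2 + 2 * (L2_norm (f t) * L2_norm (e s))"
  have "((\<lambda>s. ?Q s - ?D) \<longlongrightarrow> 0) (at t within {0..})"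
  proof (rule Lim_null_comparison)
    have "(?B \<longlongrightarrow> \<bar>t - t\<bar> * (L2_norm g + 0)\<^sup>2 + 2 * (L2_norm (f t) * 0)) (at t within {0..})"
      by (intro tendsto_intros lim)
    then show "(?B \<longlongrightarrow> 0) (at t within {0..})" by simp
    show "\<forall>\<^sub>F s in at t within {0..}. norm (?Q s - ?D) \<le> ?B s"
      using eventually_quotient_in_L2[OF f t g]
    proof eventually_elim
      case (elim s)
      then have e: "e s \<in> L2" and s: "s \<noteq> t" by (auto simp: e_def[abs_def])
      have q: "(\<lambda>x. g x + 1 * e s x) \<in> L2" using L2_add[OF g e] by simp
      let ?q = "L2_norm (\<lambda>x. g x + 1 * e s x)"
      have "f s = (\<lambda>x. f t x + (s - t) * (g x + 1 * e s x))"
        using s by (auto simp: e_def)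
      then have "(L2_norm (f s))\<^sup>2
          = (L2_norm (f t))\<^sup>2 + 2 * (s - t) * (\<integral>x. f t x * (g x + 1 * e s x) \<partial>torus) + (s - t)\<^sup>2 * ?q\<^sup>2"
        by (simp only: L2_norm_add_scale_sq[OF ft q, of "s - t"])
      then have "?Q s = (2 * (s - t) * (\<integral>x. f t x * (g x + 1 * e s x) \<partial>torus) + (s - t)\<^sup>2 * ?q\<^sup>2) / (s - t)"
        by simp
      also have "\<dots> = 2 * (\<integral>x. f t x * (g x + 1 * e s x) \<partial>torus) + (s - t) * ?q\<^sup>2"
        by (rule quotient) (use s in simp)
      also have "(\<integral>x. f t x * (g x + 1 * e s x) \<partial>torus)
          = (\<integral>x. f t x * g x \<partial>torus) + (\<integral>x. f t x * e s x \<partial>torus)"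
        using L2_integrable_mult[OF ft g] L2_integrable_mult[OF ft e]
        by (simp add: distrib_left)
      finally have "?Q s - ?D = (s - t) * ?q\<^sup>2 + 2 * (\<integral>x. f t x * e s x \<partial>torus)" by simp
      also have "norm \<dots> \<le> \<bar>s - t\<bar> * ?q\<^sup>2 + 2 * \<bar>\<integral>x. f t x * e s x \<partial>torus\<bar>"
        unfolding real_norm_def by (rule order_trans[OF abs_triangle_ineq]) (simp add: abs_mult)
      also have "\<dots> \<le> ?B s"
        using L2_norm_add_scale_le[OF g e, of 1] L2_Cauchy_Schwarz[OF ft e]
        by (intro add_mono mult_left_mono power_mono) (auto simp: L2_norm_nonneg)
      finally show ?case .
    qed
  qed
  then show ?thesis
    unfolding has_field_derivative_iff using LIM_zero_iff by blast
qed

section \<open>Test functions\<close>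

text \<open>
  Smoothness in the sense of all iterated derivatives is obtained without computing any of them:
  the restriction of an entire function to the real line is smooth, and entire functions are closed
  under composition.
\<close>

lemma torus_smooth_entire:
  assumes F: "F holomorphic_on UNIV" and real: "\<And>x. F (complex_of_real x) = complex_of_real (f x)"
    and periodic: "periodic f"
  shows "torus_smooth f"
proof -
  have D: "((\<lambda>x. Re ((deriv ^^ k) F (complex_of_real x))) has_real_derivative
      Re ((deriv ^^ Suc k) F (complex_of_real x))) (at x)" for k x
  proof -
    have "((deriv ^^ k) F has_field_derivative (deriv ^^ Suc k) F (complex_of_real x)) (at (complex_of_real x))"
      by (rule has_field_derivative_higher_deriv[OF F]) auto
    then have "((\<lambda>x. (deriv ^^ k) F (complex_of_real x)) has_vector_derivative
        (deriv ^^ Suc k) F (complex_of_real x)) (at x)"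
      by (rule has_vector_derivative_real_field)
    then show ?thesis
      unfolding has_real_derivative_iff_has_vector_derivative
      by (rule bounded_linear.has_vector_derivative[OF bounded_linear_Re])
  qed
  have "(deriv ^^ k) f = (\<lambda>x. Re ((deriv ^^ k) F (complex_of_real x)))" for k
  proof (induction k)
    case 0
    then show ?case by (simp add: real)
  next
    case (Suc k)
    then show ?case
      using D[of k] by (auto intro!: DERIV_imp_deriv)
  qed
  then show ?thesis
    using D periodic unfolding torus_smooth_def differentiable_on_def
    by (auto simp: real_differentiable_def simp del: funpow.simps intro!: differentiable_at_withinI)
qed

lemma torus_smooth_periodic: "torus_smooth \<phi> \<Longrightarrow> periodic \<phi>"
  by (simp add: torus_smooth_def)

lemma torus_smooth_has_derivative:
  assumes "torus_smooth \<phi>"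
  shows "(\<phi> has_real_derivative deriv \<phi> x) (at x)"
proof -
  have "(deriv ^^ 0) \<phi> differentiable_on UNIV"
    using assms torus_smooth_def by blast
  then show ?thesis
    by (auto simp: differentiable_on_def DERIV_deriv_iff_real_differentiable)
qed

lemma torus_smooth_continuous: "torus_smooth \<phi> \<Longrightarrow> continuous_on A \<phi>"
  using torus_smooth_has_derivative by (meson DERIV_isCont continuous_at_imp_continuous_on)

lemma torus_smooth_deriv_continuous: "torus_smooth \<phi> \<Longrightarrow> continuous_on A (deriv \<phi>)"
proof -
  assume "torus_smooth \<phi>"
  then have "(deriv ^^ 1) \<phi> differentiable_on UNIV"
    unfolding torus_smooth_def by blast
  then show ?thesis
    using differentiable_imp_continuous_on continuous_on_subset by fastforce
qed

lemma continuous_torus_measurable: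
  fixes \<phi> :: "real \<Rightarrow> real"
  assumes "continuous_on UNIV \<phi>"
  shows "\<phi> \<in> borel_measurable torus"
  using assms by (intro borel_measurable_torus borel_measurable_continuous_onI)

lemma continuous_torus_bounded:
  fixes \<phi> :: "real \<Rightarrow> real"
  assumes "continuous_on UNIV \<phi>"
  obtains C where "AE x in torus. \<bar>\<phi> x\<bar> \<le> C"
proof -
  have "compact (\<phi> ` {0..1})"
    using assms by (intro compact_continuous_image continuous_on_subset[OF assms]) auto
  then obtain C where "\<forall>x\<in>{0..1}. \<bar>\<phi> x\<bar> \<le> C"
    by (auto simp: bounded_iff dest!: compact_imp_bounded)
  then have "AE x in torus. \<bar>\<phi> x\<bar> \<le> C"
    by (intro AE_I2) simp
  then show ?thesis by (rule that)
qed

lemma continuous_torus_integrable: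
  fixes \<phi> :: "real \<Rightarrow> real"
  assumes "continuous_on UNIV \<phi>"
  shows "integrable torus \<phi>"
proof -
  obtain C where "AE x in torus. \<bar>\<phi> x\<bar> \<le> C"
    by (rule continuous_torus_bounded[OF assms])
  then show ?thesis
    using integrable_AE_bounded_mult[of torus "\<lambda>_. 1" \<phi> C] continuous_torus_measurable[OF assms] by simp
qed

lemma integrable_mult_continuous:
  fixes h \<phi> :: "real \<Rightarrow> real"
  assumes h: "integrable torus h" and \<phi>: "continuous_on UNIV \<phi>"
  shows "integrable torus (\<lambda>x. h x * \<phi> x)"
proof -
  obtain C where "AE x in torus. \<bar>\<phi> x\<bar> \<le> C"
    by (rule continuous_torus_bounded[OF \<phi>])
  from integrable_AE_bounded_mult[OF h continuous_torus_measurable[OF \<phi>] this]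
  show ?thesis by (simp add: mult.commute)
qed

lemma torus_smooth_L2:
  assumes "torus_smooth \<phi>"
  shows "\<phi> \<in> L2"
  using assms torus_smooth_periodic
  by (auto simp: L2_def intro!: continuous_torus_measurable continuous_torus_integrable
      torus_smooth_continuous continuous_intros)

lemma torus_smooth_const: "torus_smooth (\<lambda>_. c)"
  by (rule torus_smooth_entire[where F = "\<lambda>_. complex_of_real c"]) (auto simp: periodic_def)

text \<open>
  The function \<open>sin (\<pi> y) sin (\<pi> (a - y))\<close> is periodic, positive on \<open>(0, a)\<close> and negative on
  \<open>(a, 1)\<close>. The double exponential turns these signs into the limits \<open>1\<close> and \<open>0\<close>.
\<close>

definition bump :: "real \<Rightarrow> nat \<Rightarrow> real \<Rightarrow> real" where
  "bump a n y = exp (- exp (- (real n * (sin (pi * y) * sin (pi * (a - y))))))"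

lemma bump_smooth: "torus_smooth (bump a n)"
proof (rule torus_smooth_entire)
  show "(\<lambda>z. exp (- exp (- (of_nat n * (sin (of_real pi * z) * sin (of_real pi * (of_real a - z)))))))
      holomorphic_on UNIV"
    by (intro holomorphic_intros)
  show "exp (- exp (- (of_nat n * (sin (of_real pi * of_real x) * sin (of_real pi * (of_real a - of_real x))))))
      = complex_of_real (bump a n x)" for x
    by (simp add: bump_def flip: sin_of_real exp_of_real)
  have "sin (pi * (a - (x + 1))) = - sin (pi * (a - x))" for x
    using sin_minus_pi[of "pi * (a - x)"] by (simp add: algebra_simps)
  then show "periodic (bump a n)"
    by (simp add: periodic_def bump_def distrib_left)
qed

lemma bump_le_1: "\<bar>bump a n x\<bar> \<le> 1"
  by (simp add: bump_def)

lemma bump_tendsto: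
  assumes a: "0 < a" "a < 1" and x: "0 < x" "x < 1" "x \<noteq> a"
  shows "(\<lambda>n. bump a n x) \<longlonglongrightarrow> indicator {..a} x"
proof -
  let ?s = "sin (pi * x) * sin (pi * (a - x))"
  have "0 < pi * x" "pi * x < pi"
    using x by auto
  then have sin_x: "0 < sin (pi * x)"
    by (rule sin_gt_zero)
  show ?thesis
  proof (cases "x < a")
    case True
    then have "0 < pi * (a - x)" "pi * (a - x) < pi * 1"
      using a x by (auto intro!: mult_strict_left_mono)
    then have "0 < ?s"
      using sin_x sin_gt_zero[of "pi * (a - x)"] by simp
    then have "(\<lambda>n. exp (- exp (- (real n * ?s)))) \<longlonglongrightarrow> exp (- 0)"
      by (intro tendsto_intros filterlim_compose[OF exp_at_bot]
          filterlim_compose[OF filterlim_uminus_at_bot_at_top]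
          filterlim_at_top_mult_tendsto_pos[OF tendsto_const] filterlim_real_sequentially)
    then show ?thesis
      using True by (simp add: bump_def)
  next
    case False
    then have "a < x" using x by simp
    then have "0 < pi * (x - a)" "pi * (x - a) < pi * 1"
      using a x by (auto intro!: mult_strict_left_mono)
    then have "0 < sin (pi * x) * sin (pi * (x - a))"
      using sin_x sin_gt_zero[of "pi * (x - a)"] by simp
    then have pos: "0 < - ?s"
      using sin_minus[of "pi * (x - a)"] by (simp add: algebra_simps)
    then have "(\<lambda>n. exp (- exp (real n * - ?s))) \<longlonglongrightarrow> 0"
      by (intro filterlim_compose[OF exp_at_bot] filterlim_compose[OF filterlim_uminus_at_bot_at_top]
          filterlim_compose[OF exp_at_top] filterlim_at_top_mult_tendsto_pos[OF tendsto_const]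
          filterlim_real_sequentially)
    then show ?thesis
      using \<open>a < x\<close> by (simp add: bump_def)
  qed
qed

text \<open>The bumps are bounded by \<open>1\<close>, so dominated convergence applies.\<close>

lemma integral_initial_segment_eq_0:
  assumes h: "integrable torus h"
    and orth: "\<And>\<psi>. torus_smooth \<psi> \<Longrightarrow> (\<integral>x. h x * \<psi> x \<partial>torus) = 0"
  shows "(\<integral>x. indicator {..a} x * h x \<partial>torus) = 0"
proof -
  consider "a \<le> 0" | "1 \<le> a" | "0 < a" "a < 1" by linarith
  then show ?thesis
  proof cases
    case 1
    have "AE x in torus. indicator {..a} x * h x = 0"
      using AE_space AE_torus_neq[of 0]
      by eventually_elim (use 1 in \<open>auto simp: indicator_def\<close>)
    then show ?thesis by (rule integral_eq_zero_AE)
  next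
    case 2
    have "(\<integral>x. indicator {..a} x * h x \<partial>torus) = (\<integral>x. h x * 1 \<partial>torus)"
      using 2 by (intro Bochner_Integration.integral_cong) (auto simp: indicator_def)
    then show ?thesis
      using orth[OF torus_smooth_const[of 1]] by simp
  next
    case 3
    note [measurable] = borel_measurable_integrable[OF h] L2_measurable[OF torus_smooth_L2[OF bump_smooth]]
    have "(\<lambda>n. \<integral>x. h x * bump a n x \<partial>torus) \<longlonglongrightarrow> (\<integral>x. indicator {..a} x * h x \<partial>torus)"
    proof (rule integral_dominated_convergence)
      show "(\<lambda>x. indicator {..a} x * h x) \<in> borel_measurable torus"
        by (intro borel_measurable_times borel_measurable_torus[of "indicator {..a}"]) auto
      show "(\<lambda>x. h x * bump a n x) \<in> borel_measurable torus" for n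
        by measurable
      show "integrable torus (\<lambda>x. \<bar>h x\<bar>)" using h by simp
      show "AE x in torus. norm (h x * bump a n x) \<le> \<bar>h x\<bar>" for n
        using bump_le_1[of a n] by (auto simp: abs_mult intro!: AE_I2 mult_left_le)
      show "AE x in torus. (\<lambda>n. h x * bump a n x) \<longlonglongrightarrow> indicator {..a} x * h x"
        using AE_space AE_torus_neq[of 0] AE_torus_neq[of 1] AE_torus_neq[of a]
      proof eventually_elim
        case (elim x)
        then have "(\<lambda>n. h x * bump a n x) \<longlonglongrightarrow> h x * indicator {..a} x"
          using 3 by (intro tendsto_mult tendsto_const bump_tendsto) auto
        then show ?case by (simp add: mult.commute)
      qed
    qed
    then show ?thesis
      using orth[OF bump_smooth] LIMSEQ_unique[OF _ tendsto_const] by auto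
  qed
qed

text \<open>
  The initial segments form a \<open>\<pi>\<close>-system generating the Borel sets, and a Lebesgue measurable set
  differs from a Borel set by a null set.
\<close>

lemma set_integral_eq_0_if_initial_segments:
  fixes f :: "real \<Rightarrow> real"
  assumes f: "integrable lebesgue f" and total: "(LINT x|lebesgue. f x) = 0"
    and initial: "\<And>a. (LINT x:{..a}|lebesgue. f x) = 0"
    and "A \<in> sets lebesgue"
  shows "(LINT x:A|lebesgue. f x) = 0"
proof -
  have int: "set_integrable lebesgue A f" if "A \<in> sets lebesgue" for A
    using f that unfolding set_integrable_def by (rule integrable_mult_indicator[rotated])
  have borel: "(LINT x:A|lebesgue. f x) = 0" if A: "A \<in> sets borel" for A
  proof -
    let ?G = "range (\<lambda>a::real. {..a})"
    have "Int_stable ?G" "?G \<subseteq> Pow UNIV" "A \<in> sigma_sets UNIV ?G"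
      using A by (auto simp: borel_eq_atMost Int_stable_def image_iff)
    then show ?thesis
    proof (induction rule: sigma_sets_induct_disjoint)
      case (basic A)
      then show ?case using initial by auto
    next
      case empty
      show ?case by (simp add: set_lebesgue_integral_def)
    next
      case (compl A)
      then have "A \<in> sets borel" by (simp add: borel_eq_atMost)
      then have "A \<in> sets lebesgue" by simp
      then have "(LINT x:A \<union> (UNIV - A)|lebesgue. f x) = (LINT x:A|lebesgue. f x) + (LINT x:UNIV - A|lebesgue. f x)"
        by (intro set_integral_Un int) auto
      then show ?case
        using total compl by (simp add: set_lebesgue_integral_def)
    next
      case (union B)
      then have "B i \<in> sets borel" for i by (auto simp: borel_eq_atMost)
      then have "B i \<in> sets lebesgue" for i by simp
      then have "(LINT x:(\<Union>i. B i)|lebesgue. f x) = (\<Sum>i. (LINT x:B i|lebesgue. f x))"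
        using union by (intro lebesgue_integral_countable_add int) (auto simp: disjoint_family_on_def)
      then show ?case using union by simp
    qed
  qed
  from \<open>A \<in> sets lebesgue\<close> obtain S N N' where A: "A = S \<union> N" "N \<subseteq> N'" "N' \<in> null_sets lborel" "S \<in> sets lborel"
    by (rule sets_completionE)
  have "AE x in lebesgue. x \<notin> N'"
    using A by (intro AE_not_in null_sets_completionI)
  then have "AE x in lebesgue. x \<in> A \<longleftrightarrow> x \<in> S"
    by eventually_elim (use A in auto)
  then have "(LINT x:A|lebesgue. f x) = (LINT x:S|lebesgue. f x)"
    using int[of A] int[of S] \<open>A \<in> sets lebesgue\<close> A(1,4)
    by (intro set_integral_cong_set) (auto simp: set_borel_measurable_def set_integrable_def)
  also have "\<dots> = 0" using A borel by simp
  finally show ?thesis .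
qed

text \<open>
  The fundamental lemma of the calculus of variations. The bumps turn orthogonality to smooth
  functions into vanishing integrals over initial segments.
\<close>

lemma AE_eq_0_if_orthogonal_to_smooth:
  assumes h: "integrable torus h"
    and orth: "\<And>\<psi>. torus_smooth \<psi> \<Longrightarrow> (\<integral>x. h x * \<psi> x \<partial>torus) = 0"
  shows "AE x in torus. h x = 0"
proof -
  let ?f = "\<lambda>x. indicator {0..1} x *\<^sub>R h x"
  have restrict: "(\<integral>x. g x \<partial>torus) = (LINT x|lebesgue. indicator {0..1} x *\<^sub>R g x)" for g :: "real \<Rightarrow> real"
    unfolding torus_def by (rule integral_restrict_space) simp
  have int: "integrable lebesgue ?f"
    using h unfolding torus_def by (subst (asm) integrable_restrict_space) simp_all
  have total: "(LINT x|lebesgue. ?f x) = 0"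
    using orth[OF torus_smooth_const[of 1]] restrict[of h] by simp
  have initial: "(LINT x:{..a}|lebesgue. ?f x) = 0" for a
    using integral_initial_segment_eq_0[OF h orth, of a]
    by (simp add: restrict set_lebesgue_integral_def mult_ac)
  show ?thesis
  proof (rule torus.density_zero[OF h])
    fix A assume "A \<in> sets torus"
    then have "A \<in> sets lebesgue"
      unfolding torus_def by (auto simp: sets_restrict_space)
    then have "(LINT x:A|lebesgue. ?f x) = 0"
      by (rule set_integral_eq_0_if_initial_segments[OF int total initial])
    then show "(LINT x:A|torus. h x) = 0"
      by (simp add: restrict set_lebesgue_integral_def mult_ac)
  qed
qed

section \<open>Absolutely continuous representatives\<close>

text \<open>
  This says that \<open>F\<close> is absolutely continuous on the unit interval with derivative \<open>f\<close> almost
  everywhere. The integral formula is what the proofs compute with; pointwise derivatives of \<open>F\<close>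
  never enter. Writing the increment on the left keeps the equation terminating as a rewrite rule,
  as \<open>x = 0\<close> is a permitted instance.
\<close>

definition primitive :: "(real \<Rightarrow> real) \<Rightarrow> (real \<Rightarrow> real) \<Rightarrow> bool" where
  "primitive F f \<longleftrightarrow> integrable torus f \<and>
     (\<forall>x\<in>{0..1}. F x - F 0 = (\<integral>s. (if s \<le> x then f s else 0) \<partial>torus))"

lemma primitiveI:
  assumes "integrable torus f"
    and "\<And>x. x \<in> {0..1} \<Longrightarrow> F x = F 0 + (\<integral>s. (if s \<le> x then f s else 0) \<partial>torus)"
  shows "primitive F f"
  unfolding primitive_def
proof (intro conjI ballI)
  fix x :: real assume "x \<in> {0..1}"
  from assms(2)[OF this] show "F x - F 0 = (\<integral>s. (if s \<le> x then f s else 0) \<partial>torus)"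
    by linarith
qed (rule assms)

lemma primitive_integrable: "primitive F f \<Longrightarrow> integrable torus f"
  by (simp add: primitive_def)

lemma primitive_eq:
  assumes "primitive F f" "x \<in> {0..1}"
  shows "F x = F 0 + (\<integral>s. (if s \<le> x then f s else 0) \<partial>torus)"
proof -
  from assms have "F x - F 0 = (\<integral>s. (if s \<le> x then f s else 0) \<partial>torus)"
    unfolding primitive_def by blast
  then show ?thesis by linarith
qed

lemma measurable_ident_torus [measurable]: "(\<lambda>x. x) \<in> borel_measurable torus"
  by (intro borel_measurable_torus) simp

lemma measurable_le_torus:
  "Measurable.pred (torus \<Otimes>\<^sub>M torus) (\<lambda>p. fst p \<le> snd p)"
  "Measurable.pred (torus \<Otimes>\<^sub>M torus) (\<lambda>p. snd p \<le> fst p)"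
proof -
  have [measurable]: "fst \<in> borel_measurable (torus \<Otimes>\<^sub>M torus)" "snd \<in> borel_measurable (torus \<Otimes>\<^sub>M torus)"
    using measurable_ident_torus
    by (auto intro: measurable_compose[OF measurable_fst] measurable_compose[OF measurable_snd])
  show "Measurable.pred (torus \<Otimes>\<^sub>M torus) (\<lambda>p. fst p \<le> snd p)"
    "Measurable.pred (torus \<Otimes>\<^sub>M torus) (\<lambda>p. snd p \<le> fst p)"
    by measurable
qed

lemma integrable_initial_segment:
  assumes "integrable torus f"
  shows "integrable torus (\<lambda>s. if s \<le> x then f s else 0 :: real)"
proof (rule Bochner_Integration.integrable_bound[OF assms])
  show "(\<lambda>s. if s \<le> x then f s else 0) \<in> borel_measurable torus"
    using borel_measurable_integrable[OF assms] by measurable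
qed simp

lemma initial_segment_measurable:
  assumes [measurable]: "f \<in> borel_measurable torus"
  shows "(\<lambda>x. \<integral>s. (if s \<le> x then f s else 0 :: real) \<partial>torus) \<in> borel_measurable torus"
proof (rule torus.borel_measurable_lebesgue_integral)
  note [measurable] = measurable_le_torus
  show "(\<lambda>(x, s). if s \<le> x then f s else 0) \<in> borel_measurable (torus \<Otimes>\<^sub>M torus)"
    unfolding case_prod_beta by measurable
qed

lemma initial_segment_bounded:
  fixes f :: "real \<Rightarrow> real"
  assumes f: "integrable torus f"
  shows "\<bar>\<integral>s. (if s \<le> x then f s else 0) \<partial>torus\<bar> \<le> (\<integral>s. \<bar>f s\<bar> \<partial>torus)"
proof -
  have "\<bar>\<integral>s. (if s \<le> x then f s else 0) \<partial>torus\<bar> \<le> (\<integral>s. \<bar>if s \<le> x then f s else 0\<bar> \<partial>torus)"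
    unfolding real_norm_def[symmetric] by (rule integral_norm_bound)
  also have "\<dots> \<le> (\<integral>s. \<bar>f s\<bar> \<partial>torus)"
    using f integrable_initial_segment[OF f] by (intro integral_mono) auto
  finally show ?thesis .
qed

lemma primitive_bounded:
  assumes "primitive F f"
  obtains C where "\<And>x. x \<in> {0..1} \<Longrightarrow> \<bar>F x\<bar> \<le> C"
proof (rule that)
  fix x :: real assume "x \<in> {0..1}"
  then show "\<bar>F x\<bar> \<le> \<bar>F 0\<bar> + (\<integral>s. \<bar>f s\<bar> \<partial>torus)"
    using primitive_eq[OF assms, of x] initial_segment_bounded[OF primitive_integrable[OF assms], of x]
    by linarith
qed

lemma primitive_measurable:
  assumes "primitive F f"
  shows "F \<in> borel_measurable torus"
proof -
  have "(\<lambda>x. F 0 + (\<integral>s. (if s \<le> x then f s else 0) \<partial>torus)) \<in> borel_measurable torus"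
    by (intro borel_measurable_add borel_measurable_const initial_segment_measurable
        borel_measurable_integrable primitive_integrable[OF assms])
  also have "?this \<longleftrightarrow> F \<in> borel_measurable torus"
    by (intro measurable_cong primitive_eq[OF assms, symmetric]) simp
  finally show ?thesis .
qed

lemma primitive_integrable_mult:
  assumes F: "primitive F f" and g: "integrable torus g"
  shows "integrable torus (\<lambda>x. F x * g x)"
proof -
  obtain C where "\<And>x. x \<in> {0..1} \<Longrightarrow> \<bar>F x\<bar> \<le> C"
    using primitive_bounded[OF F] by blast
  then show ?thesis
    by (intro integrable_AE_bounded_mult[OF g primitive_measurable[OF F], where C = C] AE_I2) simp
qed

lemma primitive_at_1:
  assumes "primitive F f"
  shows "F 1 = F 0 + (\<integral>x. f x \<partial>torus)"
proof -
  have "(\<integral>s. (if s \<le> 1 then f s else 0) \<partial>torus) = (\<integral>x. f x \<partial>torus)"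
    by (intro Bochner_Integration.integral_cong) auto
  then show ?thesis
    using primitive_eq[OF assms, of 1] by simp
qed

lemma primitive_initial_segment:
  assumes f: "integrable torus f"
  shows "primitive (\<lambda>x. \<integral>s. (if s \<le> x then f s else 0) \<partial>torus) f"
proof -
  have "AE s in torus. (if s \<le> 0 then f s else 0) = 0"
    using AE_space AE_torus_neq[of 0] by eventually_elim auto
  then have "(\<integral>s. (if s \<le> 0 then f s else 0) \<partial>torus) = 0"
    by (rule integral_eq_zero_AE)
  then show ?thesis
    by (intro primitiveI f) simp
qed

lemma integrable_prod_torus:
  fixes f g :: "real \<Rightarrow> real"
  assumes f: "integrable torus f" and g: "integrable torus g"
  shows "integrable (torus \<Otimes>\<^sub>M torus) (\<lambda>(s, t). f s * g t)"
proof -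
  interpret pair_sigma_finite torus torus ..
  note [measurable] = borel_measurable_integrable[OF f] borel_measurable_integrable[OF g]
  show ?thesis
  proof (rule Fubini_integrable)
    show "(\<lambda>(s, t). f s * g t) \<in> borel_measurable (torus \<Otimes>\<^sub>M torus)"
      by measurable
  qed (use f g in \<open>simp_all add: abs_mult\<close>)
qed

text \<open>
  Integration by parts without differentiability: \<open>\<integral>f \<integral>g\<close> over \<open>[0, x]\<close> is a double integral, and
  Fubini's theorem is applied to each of the two triangles into which the diagonal cuts the square.
\<close>

lemma integral_initial_segments_mult:
  assumes f: "integrable torus f" and g: "integrable torus g"
  defines "I \<equiv> \<lambda>f x. \<integral>s. (if s \<le> x then f s else 0 :: real) \<partial>torus"
  shows "I f x * I g x = I (\<lambda>s. I f s * g s + f s * I g s) x"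
proof -
  interpret pair_sigma_finite torus torus ..
  define a b where "a s = (if s \<le> x then f s else 0)" and "b s = (if s \<le> x then g s else 0)" for s
  have a: "integrable torus a" and b: "integrable torus b"
    unfolding a_def[abs_def] b_def[abs_def] by (intro integrable_initial_segment f g)+
  note ab = integrable_prod_torus[OF a b]
  note [measurable] = borel_measurable_integrable[OF ab]
  define lower where "lower p = (if fst p \<le> snd p then a (fst p) * b (snd p) else 0)" for p
  define upper where "upper p = (if fst p \<le> snd p then 0 else a (fst p) * b (snd p))" for p
  have lower: "integrable (torus \<Otimes>\<^sub>M torus) lower" and upper: "integrable (torus \<Otimes>\<^sub>M torus) upper"
    unfolding lower_def[abs_def] upper_def[abs_def]
    by (rule Bochner_Integration.integrable_bound[OF ab];
        use measurable_le_torus borel_measurable_integrable[OF ab] in \<open>auto simp: case_prod_beta intro!: measurable_If\<close>)+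
  have "(\<integral>p. lower p + upper p \<partial>(torus \<Otimes>\<^sub>M torus)) = (\<integral>(s, t). a s * b t \<partial>(torus \<Otimes>\<^sub>M torus))"
    by (intro Bochner_Integration.integral_cong) (auto simp: lower_def upper_def)
  also have "\<dots> = I f x * I g x"
    using integral_fst[OF ab] by (simp add: I_def a_def b_def)
  finally have "I f x * I g x = integral\<^sup>L (torus \<Otimes>\<^sub>M torus) lower + integral\<^sup>L (torus \<Otimes>\<^sub>M torus) upper"
    using lower upper by simp
  also have "integral\<^sup>L (torus \<Otimes>\<^sub>M torus) lower = (\<integral>t. (\<integral>s. lower (s, t) \<partial>torus) \<partial>torus)"
    using integral_snd[of "\<lambda>s t. lower (s, t)"] lower by simp
  also have "\<dots> = (\<integral>t. (if t \<le> x then I f t * g t else 0) \<partial>torus)"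
  proof (intro Bochner_Integration.integral_cong refl)
    fix t
    show "(\<integral>s. lower (s, t) \<partial>torus) = (if t \<le> x then I f t * g t else 0)"
    proof (cases "t \<le> x")
      case True
      then have "lower (s, t) = (if s \<le> t then f s else 0) * g t" for s
        by (auto simp: lower_def a_def b_def)
      then show ?thesis using True by (simp add: I_def)
    next
      case False
      then have "lower (s, t) = 0" for s
        by (auto simp: lower_def b_def)
      then show ?thesis using False by simp
    qed
  qed
  also have "integral\<^sup>L (torus \<Otimes>\<^sub>M torus) upper = (\<integral>s. (\<integral>t. upper (s, t) \<partial>torus) \<partial>torus)"
    using integral_fst'[OF upper] by simp
  also have "\<dots> = (\<integral>s. (if s \<le> x then f s * I g s else 0) \<partial>torus)"
  proof (intro Bochner_Integration.integral_cong refl)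
    fix s
    show "(\<integral>t. upper (s, t) \<partial>torus) = (if s \<le> x then f s * I g s else 0)"
    proof (cases "s \<le> x")
      case True
      have "(\<integral>t. upper (s, t) \<partial>torus) = (\<integral>t. f s * (if t \<le> s then g t else 0) \<partial>torus)"
      proof (rule integral_cong_AE)
        have "AE t in torus. t \<noteq> s" by (rule AE_torus_neq)
        then show "AE t in torus. upper (s, t) = f s * (if t \<le> s then g t else 0)"
          by eventually_elim (use True in \<open>auto simp: upper_def a_def b_def\<close>)
        show "(\<lambda>t. f s * (if t \<le> s then g t else 0)) \<in> borel_measurable torus"
          using integrable_initial_segment[OF g] by auto
        show "(\<lambda>t. upper (s, t)) \<in> borel_measurable torus"
          using borel_measurable_integrable[OF b] unfolding upper_def fst_conv snd_conv by measurable
      qed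
      then show ?thesis using True by (simp add: I_def)
    next
      case False
      then have "upper (s, t) = 0" for t
        by (auto simp: upper_def a_def)
      then show ?thesis using False by simp
    qed
  qed
  also have "(\<integral>t. (if t \<le> x then I f t * g t else 0) \<partial>torus) + (\<integral>s. (if s \<le> x then f s * I g s else 0) \<partial>torus)
    = I (\<lambda>s. I f s * g s + f s * I g s) x"
  proof -
    have "integrable torus (\<lambda>t. I f t * g t)" "integrable torus (\<lambda>s. f s * I g s)"
      using primitive_integrable_mult[OF primitive_initial_segment[OF f] g]
        primitive_integrable_mult[OF primitive_initial_segment[OF g] f]
      by (simp_all add: I_def mult.commute)
    note int = this[THEN integrable_initial_segment, of x]
    have "I (\<lambda>s. I f s * g s + f s * I g s) x
      = (\<integral>s. (if s \<le> x then I f s * g s else 0) + (if s \<le> x then f s * I g s else 0) \<partial>torus)"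
      unfolding I_def by (intro Bochner_Integration.integral_cong refl) simp
    then show ?thesis
      by (simp only: Bochner_Integration.integral_add[OF int])
  qed
  finally show ?thesis .
qed

lemma primitive_mult:
  assumes F: "primitive F f" and G: "primitive G g"
  shows "primitive (\<lambda>x. F x * G x) (\<lambda>x. F x * g x + f x * G x)"
proof -
  have f: "integrable torus f" and g: "integrable torus g"
    using F G by (auto intro: primitive_integrable)
  let ?I = "\<lambda>f x. \<integral>s. (if s \<le> x then f s else 0 :: real) \<partial>torus"
  have F': "F x = F 0 + ?I f x" and G': "G x = G 0 + ?I g x" if "x \<in> {0..1}" for x
    using primitive_eq[OF F that] primitive_eq[OF G that] by auto
  have "F x * G x = F 0 * G 0 + ?I (\<lambda>s. F s * g s + f s * G s) x" if x: "x \<in> {0..1}" for x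
  proof -
    have i: "integrable torus (\<lambda>s. if s \<le> x then ?I f s * g s + f s * ?I g s else 0)"
      using primitive_integrable_mult[OF primitive_initial_segment[OF f] g]
        primitive_integrable_mult[OF primitive_initial_segment[OF g] f]
      by (intro integrable_initial_segment) (simp add: mult.commute)
    have eq: "?I (\<lambda>s. F s * g s + f s * G s) x
      = (\<integral>s. F 0 * (if s \<le> x then g s else 0) + G 0 * (if s \<le> x then f s else 0)
          + (if s \<le> x then ?I f s * g s + f s * ?I g s else 0) \<partial>torus)"
    proof (intro Bochner_Integration.integral_cong refl)
      fix s assume "s \<in> space torus"
      then have "s \<in> {0..1}" by simp
      from F'[OF this] G'[OF this]
      have "F s * g s + f s * G s = (F 0 + ?I f s) * g s + f s * (G 0 + ?I g s)"
        by (rule arg_cong2[where f = "\<lambda>a b. a * g s + f s * b"])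
      then show "(if s \<le> x then F s * g s + f s * G s else 0)
        = F 0 * (if s \<le> x then g s else 0) + G 0 * (if s \<le> x then f s else 0)
          + (if s \<le> x then ?I f s * g s + f s * ?I g s else 0)"
        by (simp only: if_split) (simp add: algebra_simps)
    qed
    have "F 0 * G 0 + ?I (\<lambda>s. F s * g s + f s * G s) x
      = F 0 * G 0 + (F 0 * ?I g x + G 0 * ?I f x + ?I f x * ?I g x)"
      unfolding eq
      using integrable_initial_segment[OF f] integrable_initial_segment[OF g] i
      by (simp add: integral_initial_segments_mult[OF f g])
    also have "\<dots> = (F 0 + ?I f x) * (G 0 + ?I g x)"
      by (simp add: algebra_simps)
    also have "\<dots> = F x * G x"
      by (simp only: F'[OF x] G'[OF x])
    finally show ?thesis ..
  qed
  moreover have "integrable torus (\<lambda>x. F x * g x + f x * G x)"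
    using primitive_integrable_mult[OF F g] primitive_integrable_mult[OF G f] by (simp add: mult.commute)
  ultimately show ?thesis
    by (rule primitiveI[rotated])
qed

lemma primitive_C1:
  fixes \<phi> :: "real \<Rightarrow> real"
  assumes D: "\<And>x. (\<phi> has_real_derivative \<phi>' x) (at x)" and cont: "continuous_on UNIV \<phi>'"
  shows "primitive \<phi> \<phi>'"
proof -
  have int: "integrable torus \<phi>'"
    by (rule continuous_torus_integrable[OF cont])
  moreover have "\<phi> x = \<phi> 0 + (\<integral>s. (if s \<le> x then \<phi>' s else 0) \<partial>torus)" if x: "x \<in> {0..1}" for x
  proof -
    have "(\<phi>' has_integral \<phi> x - \<phi> 0) {0..x}"
      using x D by (intro fundamental_theorem_of_calculus)
        (auto simp: has_real_derivative_iff_has_vector_derivative[symmetric] has_field_derivative_at_within)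
    then have "((\<lambda>s. if s \<in> {0..x} then \<phi>' s else 0) has_integral \<phi> x - \<phi> 0) {0..1}"
      using x by (subst has_integral_restrict) auto
    then have "((\<lambda>s. if s \<le> x then \<phi>' s else 0) has_integral \<phi> x - \<phi> 0) {0..1}"
      by (rule has_integral_eq[rotated]) auto
    moreover have "((\<lambda>s. if s \<le> x then \<phi>' s else 0) has_integral
        (\<integral>s. (if s \<le> x then \<phi>' s else 0) \<partial>torus)) {0..1}"
      using integrable_initial_segment[OF int] unfolding torus_def
      by (intro has_integral_integral_lebesgue_on) auto
    ultimately have "\<phi> x - \<phi> 0 = (\<integral>s. (if s \<le> x then \<phi>' s else 0) \<partial>torus)"
      by (rule has_integral_unique)
    then show ?thesis by linarith
  qed
  ultimately show ?thesis
    by (rule primitiveI)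
qed

section \<open>Weak derivatives\<close>

lemma torus_smooth_primitive: "torus_smooth \<phi> \<Longrightarrow> primitive \<phi> (deriv \<phi>)"
  by (intro primitive_C1 torus_smooth_has_derivative torus_smooth_deriv_continuous)

lemma periodic_at_1: "periodic f \<Longrightarrow> f 1 = f 0"
  unfolding periodic_def by (metis add_0)

text \<open>The mean has to be removed for the antiderivative to be periodic.\<close>

lemma smooth_antiderivative:
  assumes \<psi>: "torus_smooth \<psi>"
  obtains \<phi> where "torus_smooth \<phi>" "deriv \<phi> = (\<lambda>x. \<psi> x - (\<integral>y. \<psi> y \<partial>torus))"
proof -
  define g where "g x = \<psi> x - (\<integral>y. \<psi> y \<partial>torus)" for x
  have cont: "continuous_on UNIV g"
    unfolding g_def[abs_def] by (intro continuous_intros torus_smooth_continuous \<psi>)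
  obtain \<phi> where "\<forall>x::real. -\<infinity> < ereal x \<longrightarrow> ereal x < \<infinity> \<longrightarrow> (\<phi> has_vector_derivative g x) (at x)"
    using einterval_antiderivative[of "-\<infinity>" "\<infinity>" g] cont
    by (auto simp: continuous_on_eq_continuous_at)
  then have D: "(\<phi> has_real_derivative g x) (at x)" for x
    by (simp add: has_real_derivative_iff_has_vector_derivative)
  then have deriv: "deriv \<phi> = g"
    by (auto intro: DERIV_imp_deriv)
  have "\<phi> 1 = \<phi> 0"
  proof -
    have "(\<integral>x. g x \<partial>torus) = 0"
      using L2_integrable[OF torus_smooth_L2[OF \<psi>]] by (simp add: g_def)
    then show ?thesis
      using primitive_at_1[OF primitive_C1[OF D cont]] by simp
  qed
  moreover have "\<phi> (x + 1) - \<phi> x = \<phi> (0 + 1) - \<phi> 0" for x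
  proof -
    have "((\<lambda>x. \<phi> (x + 1) - \<phi> x) has_real_derivative 0) (at y)" for y
    proof -
      have "g (y + 1) = g y"
        using torus_smooth_periodic[OF \<psi>] by (simp add: g_def periodic_def)
      moreover have "((\<lambda>x. \<phi> (x + 1) - \<phi> x) has_real_derivative g (y + 1) - g y) (at y)"
        by (intro DERIV_diff D) (simp add: DERIV_shift[symmetric] D)
      ultimately show ?thesis by simp
    qed
    then have "\<forall>y. ((\<lambda>x. \<phi> (x + 1) - \<phi> x) has_real_derivative 0) (at y)" ..
    from DERIV_isconst_all[OF this, of x 0] show ?thesis by simp
  qed
  ultimately have "periodic \<phi>" by (simp add: periodic_def)
  moreover have "(deriv ^^ k) \<phi> differentiable_on UNIV" for k
  proof (cases k)
    case 0
    then show ?thesis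
      using D by (auto simp: differentiable_on_def real_differentiable_def intro: differentiable_at_withinI)
  next
    case (Suc j)
    have "(deriv ^^ k) \<phi> = (deriv ^^ j) g"
      unfolding Suc funpow_Suc_right by (simp add: deriv)
    moreover have "(deriv ^^ j) g differentiable_on UNIV"
    proof (cases j)
      case 0
      have "(deriv ^^ 0) \<psi> differentiable_on UNIV"
        using \<psi> torus_smooth_def by blast
      then show ?thesis using 0 by (simp add: g_def[abs_def])
    next
      case (Suc i)
      have "deriv g = deriv \<psi>"
        using DERIV_diff[OF torus_smooth_has_derivative[OF \<psi>] DERIV_const[of "\<integral>y. \<psi> y \<partial>torus"]]
        by (intro ext) (simp add: g_def[abs_def] DERIV_imp_deriv)
      then have "(deriv ^^ j) g = (deriv ^^ j) \<psi>"
        unfolding Suc funpow_Suc_right by simp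
      then show ?thesis
        using \<psi> by (simp add: torus_smooth_def)
    qed
    ultimately show ?thesis by simp
  qed
  ultimately have "torus_smooth \<phi>" by (simp add: torus_smooth_def)
  with deriv show ?thesis
    by (intro that) (simp_all add: g_def[abs_def])
qed


lemma integral_weak_deriv:
  assumes "has_weak_deriv f g"
  shows "(\<integral>x. g x \<partial>torus) = 0"
proof -
  have "(\<integral>x. f x * deriv (\<lambda>_. 1) x \<partial>torus) = - (\<integral>x. g x * 1 \<partial>torus)"
    using assms torus_smooth_const[of 1] unfolding has_weak_deriv_def by blast
  then show ?thesis by simp
qed

text \<open>
  A weak derivative is an ordinary density, for the absolutely continuous representative. If \<open>G\<close> is
  the primitive of the weak derivative, then \<open>f - G\<close> is orthogonal to derivatives of test functions,
  hence to all test functions of mean zero, and so is constant.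
\<close>

lemma has_weak_deriv_iff_primitive:
  "has_weak_deriv f g \<longleftrightarrow>
    f \<in> L2 \<and> g \<in> L2 \<and> (\<exists>F. primitive F g \<and> F 1 = F 0 \<and> (AE x in torus. f x = F x))"
proof (intro iffI conjI; (elim conjE exE)?)
  assume fg: "has_weak_deriv f g"
  then show f: "f \<in> L2" and g: "g \<in> L2"
    by (auto simp: has_weak_deriv_def)
  note int_f = L2_integrable[OF f] and int_g = L2_integrable[OF g]
  define G where "G x = (\<integral>s. (if s \<le> x then g s else 0) \<partial>torus)" for x
  have G: "primitive G g"
    unfolding G_def[abs_def] by (rule primitive_initial_segment[OF int_g])
  have int_G: "integrable torus G"
    using primitive_integrable_mult[OF G, of "\<lambda>_. 1"] by simp
  have "(\<integral>x. g x \<partial>torus) = 0"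
    by (rule integral_weak_deriv[OF fg])
  then have G1: "G 1 = G 0"
    using primitive_at_1[OF G] by simp
  have orth: "(\<integral>x. (f x - G x) * deriv \<phi> x \<partial>torus) = 0" if \<phi>: "torus_smooth \<phi>" for \<phi>
  proof -
    have "(\<integral>x. G x * deriv \<phi> x + g x * \<phi> x \<partial>torus) = 0"
      using primitive_at_1[OF primitive_mult[OF G torus_smooth_primitive[OF \<phi>]]]
        periodic_at_1[OF torus_smooth_periodic[OF \<phi>]] G1 by simp
    moreover have "(\<integral>x. f x * deriv \<phi> x \<partial>torus) = - (\<integral>x. g x * \<phi> x \<partial>torus)"
      using fg \<phi> by (simp add: has_weak_deriv_def)
    moreover have "integrable torus (\<lambda>x. f x * deriv \<phi> x)" "integrable torus (\<lambda>x. G x * deriv \<phi> x)"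
      "integrable torus (\<lambda>x. g x * \<phi> x)"
      using \<phi> int_f int_g int_G
      by (auto intro!: integrable_mult_continuous torus_smooth_continuous torus_smooth_deriv_continuous)
    ultimately show ?thesis
      by (simp add: left_diff_distrib)
  qed
  define h where "h x = f x - G x" for x
  have int_h: "integrable torus h"
    unfolding h_def[abs_def] using int_f int_G by simp
  define c where "c = (\<integral>x. h x \<partial>torus)"
  have "AE x in torus. h x - c = 0"
  proof (rule AE_eq_0_if_orthogonal_to_smooth)
    show "integrable torus (\<lambda>x. h x - c)"
      using int_h by simp
    fix \<psi> assume \<psi>: "torus_smooth \<psi>"
    obtain \<phi> where \<phi>: "torus_smooth \<phi>" "deriv \<phi> = (\<lambda>x. \<psi> x - (\<integral>y. \<psi> y \<partial>torus))"
      by (rule smooth_antiderivative[OF \<psi>])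
    have "integrable torus (\<lambda>x. h x * \<psi> x)"
      by (intro integrable_mult_continuous int_h torus_smooth_continuous \<psi>)
    then show "(\<integral>x. (h x - c) * \<psi> x \<partial>torus) = 0"
      using orth[OF \<phi>(1)] int_h L2_integrable[OF torus_smooth_L2[OF \<psi>]]
      by (simp add: \<phi>(2) c_def flip: h_def add: left_diff_distrib right_diff_distrib mult.commute)
  qed
  then have "AE x in torus. f x = c + G x"
    by eventually_elim (simp add: h_def)
  moreover have "primitive (\<lambda>x. c + G x) g"
    using G by (simp add: primitive_def)
  ultimately show "\<exists>F. primitive F g \<and> F 1 = F 0 \<and> (AE x in torus. f x = F x)"
    using G1 by (intro exI[of _ "\<lambda>x. c + G x"]) simp
next
  fix F assume fg: "f \<in> L2" "g \<in> L2" and F: "primitive F g" "F 1 = F 0" and ae: "AE x in torus. f x = F x"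
  have "(\<integral>x. f x * deriv \<phi> x \<partial>torus) = - (\<integral>x. g x * \<phi> x \<partial>torus)" if \<phi>: "torus_smooth \<phi>" for \<phi>
  proof -
    note [measurable] = L2_measurable[OF fg(1)] primitive_measurable[OF F(1)]
      continuous_torus_measurable[OF torus_smooth_deriv_continuous[OF \<phi>]]
    have "(\<integral>x. F x * deriv \<phi> x + g x * \<phi> x \<partial>torus) = 0"
      using primitive_at_1[OF primitive_mult[OF F(1) torus_smooth_primitive[OF \<phi>]]]
        periodic_at_1[OF torus_smooth_periodic[OF \<phi>]] F(2) by simp
    moreover have "integrable torus (\<lambda>x. F x * deriv \<phi> x)"
      by (intro primitive_integrable_mult[OF F(1)] continuous_torus_integrable
          torus_smooth_deriv_continuous \<phi>)
    moreover have "integrable torus (\<lambda>x. g x * \<phi> x)"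
      by (intro L2_integrable_mult fg torus_smooth_L2 \<phi>)
    moreover have "(\<integral>x. f x * deriv \<phi> x \<partial>torus) = (\<integral>x. F x * deriv \<phi> x \<partial>torus)"
      using ae by (intro integral_cong_AE) auto
    ultimately show ?thesis by simp
  qed
  then show "has_weak_deriv f g"
    using fg by (simp add: has_weak_deriv_def)
qed

lemma has_weak_derivE:
  assumes "has_weak_deriv f g"
  obtains F where "f \<in> L2" "g \<in> L2" "primitive F g" "F 1 = F 0" "AE x in torus. f x = F x"
  using assms has_weak_deriv_iff_primitive by blast

lemma has_weak_deriv_unique:
  assumes "has_weak_deriv f g" "has_weak_deriv f g'"
  shows "AE x in torus. g x = g' x"
proof -
  have g: "g \<in> L2" "g' \<in> L2"
    using assms by (auto simp: has_weak_deriv_def)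
  have "AE x in torus. g x - g' x = 0"
  proof (rule AE_eq_0_if_orthogonal_to_smooth)
    show "integrable torus (\<lambda>x. g x - g' x)"
      using g by (simp add: L2_integrable)
    fix \<psi> assume \<psi>: "torus_smooth \<psi>"
    then have "(\<integral>x. g x * \<psi> x \<partial>torus) = (\<integral>x. g' x * \<psi> x \<partial>torus)"
      using assms unfolding has_weak_deriv_def by (metis neg_equal_iff_equal)
    then show "(\<integral>x. (g x - g' x) * \<psi> x \<partial>torus) = 0"
      using L2_integrable_mult[OF g(1) torus_smooth_L2[OF \<psi>]] L2_integrable_mult[OF g(2) torus_smooth_L2[OF \<psi>]]
      by (simp add: left_diff_distrib)
  qed
  then show ?thesis by simp
qed

text \<open>The embedding of \<open>W\<^sup>1\<^sup>,\<^sup>2\<close> into \<open>L\<^sup>\<infinity>\<close>: primitives are bounded.\<close>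

lemma has_weak_deriv_bounded:
  assumes "has_weak_deriv f g"
  obtains C where "AE x in torus. \<bar>f x\<bar> \<le> C"
proof -
  obtain F where F: "primitive F g" "AE x in torus. f x = F x"
    using assms by (rule has_weak_derivE)
  obtain C where C: "\<And>x. x \<in> {0..1} \<Longrightarrow> \<bar>F x\<bar> \<le> C"
    using primitive_bounded[OF F(1)] by blast
  have "AE x in torus. \<bar>f x\<bar> \<le> C"
    using F(2) AE_space by eventually_elim (use C in simp)
  then show ?thesis by (rule that)
qed

text \<open>
  The product of the absolutely continuous representatives is a primitive. Boundedness of both
  factors puts the product and its derivative into \<open>L\<^sup>2\<close>.
\<close>

lemma has_weak_deriv_mult:
  assumes f: "has_weak_deriv f f'" and g: "has_weak_deriv g g'"
  shows "has_weak_deriv (\<lambda>x. f x * g x) (\<lambda>x. f x * g' x + f' x * g x)"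
proof -
  obtain F where F: "f \<in> L2" "f' \<in> L2" "primitive F f'" "F 1 = F 0" "AE x in torus. f x = F x"
    by (rule has_weak_derivE[OF f])
  obtain G where G: "g \<in> L2" "g' \<in> L2" "primitive G g'" "G 1 = G 0" "AE x in torus. g x = G x"
    by (rule has_weak_derivE[OF g])
  obtain C where C: "AE x in torus. \<bar>f x\<bar> \<le> C"
    by (rule has_weak_deriv_bounded[OF f])
  obtain D where D: "AE x in torus. \<bar>g x\<bar> \<le> D"
    by (rule has_weak_deriv_bounded[OF g])
  note f_mult = L2_bounded_mult[OF _ L2_periodic[OF F(1)] L2_measurable[OF F(1)] C]
  note g_mult = L2_bounded_mult[OF _ L2_periodic[OF G(1)] L2_measurable[OF G(1)] D]
  let ?h = "\<lambda>x. f x * g' x + f' x * g x"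
  let ?H = "\<lambda>x. F x * g' x + f' x * G x"
  have h: "?h \<in> L2"
    using L2_add[OF f_mult[OF G(2)] g_mult[OF F(2)]] by (simp add: mult.commute)
  have FG: "primitive (\<lambda>x. F x * G x) ?H"
    by (rule primitive_mult[OF F(3) G(3)])
  have ae: "AE x in torus. ?H x = ?h x"
    using F(5) G(5) by eventually_elim simp
  have "primitive (\<lambda>x. F x * G x) ?h"
  proof -
    have H: "integrable torus ?H"
      by (rule primitive_integrable[OF FG])
    have eq: "(\<integral>s. (if s \<le> x then ?H s else 0) \<partial>torus) = (\<integral>s. (if s \<le> x then ?h s else 0) \<partial>torus)" for x
    proof (rule integral_cong_AE)
      show "AE s in torus. (if s \<le> x then ?H s else 0) = (if s \<le> x then ?h s else 0)"
        using ae by eventually_elim simp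
    qed (intro borel_measurable_integrable integrable_initial_segment H L2_integrable h)+
    then show ?thesis
      using primitive_eq[OF FG] L2_integrable[OF h] by (intro primitiveI) (simp_all only: eq)
  qed
  moreover have "AE x in torus. f x * g x = F x * G x"
    using F(5) G(5) by eventually_elim simp
  ultimately show ?thesis
    unfolding has_weak_deriv_iff_primitive
    using h f_mult[OF G(1)] F(4) G(4) by (intro conjI exI[of _ "\<lambda>x. F x * G x"]) simp_all
qed

text \<open>The mean of a weak derivative vanishes; apply this to the product.\<close>

lemma has_weak_deriv_by_parts:
  assumes f: "has_weak_deriv f f'" and g: "has_weak_deriv g g'"
  shows "(\<integral>x. f x * g' x \<partial>torus) = - (\<integral>x. f' x * g x \<partial>torus)"
proof -
  have L2: "f \<in> L2" "f' \<in> L2" "g \<in> L2" "g' \<in> L2"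
    using f g by (auto simp: has_weak_deriv_def)
  have "(\<integral>x. f x * g' x + f' x * g x \<partial>torus) = 0"
    by (rule integral_weak_deriv[OF has_weak_deriv_mult[OF f g]])
  then show ?thesis
    using L2 by (simp add: L2_integrable_mult)
qed

lemma has_weak_deriv_add_scale:
  assumes f: "has_weak_deriv f f'" and g: "has_weak_deriv g g'"
  shows "has_weak_deriv (\<lambda>x. f x + r * g x) (\<lambda>x. f' x + r * g' x)"
proof -
  have L2: "f \<in> L2" "f' \<in> L2" "g \<in> L2" "g' \<in> L2"
    using f g by (auto simp: has_weak_deriv_def)
  have "(\<integral>x. (f x + r * g x) * deriv \<phi> x \<partial>torus) = - (\<integral>x. (f' x + r * g' x) * \<phi> x \<partial>torus)"
    if \<phi>: "torus_smooth \<phi>" for \<phi>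
  proof -
    have int: "integrable torus (\<lambda>x. h x * \<phi> x)" "integrable torus (\<lambda>x. h x * deriv \<phi> x)" if "h \<in> L2" for h
      by (rule integrable_mult_continuous[OF L2_integrable[OF that] torus_smooth_continuous[OF \<phi>]],
          rule integrable_mult_continuous[OF L2_integrable[OF that] torus_smooth_deriv_continuous[OF \<phi>]])
    show ?thesis
      using f g \<phi> L2 int by (simp add: has_weak_deriv_def distrib_right mult.assoc)
  qed
  then show ?thesis
    using L2 L2_add[OF _ L2_scale] by (simp add: has_weak_deriv_def)
qed

lemma torus_smooth_has_weak_deriv:
  assumes \<phi>: "torus_smooth \<phi>"
  shows "has_weak_deriv \<phi> (deriv \<phi>)"
proof -
  have "deriv \<phi> (x + 1) = deriv \<phi> x" for x
  proof -
    have "((\<lambda>y. \<phi> (y + 1)) has_real_derivative deriv \<phi> (x + 1)) (at x)"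
      using torus_smooth_has_derivative[OF \<phi>, of "x + 1"] by (simp only: DERIV_shift)
    moreover have "(\<lambda>y. \<phi> (y + 1)) = \<phi>"
      using torus_smooth_periodic[OF \<phi>] by (auto simp: periodic_def)
    ultimately show ?thesis
      using torus_smooth_has_derivative[OF \<phi>, of x] DERIV_unique by fastforce
  qed
  then have "deriv \<phi> \<in> L2"
    using continuous_torus_measurable[OF torus_smooth_deriv_continuous[OF \<phi>]]
    by (auto simp: L2_def periodic_def intro!: continuous_torus_integrable continuous_intros
        torus_smooth_deriv_continuous \<phi>)
  then show ?thesis
    unfolding has_weak_deriv_iff_primitive
    using \<phi> by (auto intro!: torus_smooth_L2 torus_smooth_primitive
        periodic_at_1[OF torus_smooth_periodic] exI[of _ \<phi>])
qed

section \<open>Monotonicity of the flow\<close>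

lemma has_weak_deriv_weak_deriv:
  assumes "has_weak_deriv f g"
  shows "has_weak_deriv f (weak_deriv f)"
  unfolding weak_deriv_def using assms by (rule someI[of "has_weak_deriv f"])

lemma sobolev_1_has_weak_deriv: "f \<in> sobolev 1 \<Longrightarrow> has_weak_deriv f (weak_deriv f)"
  by (auto intro: has_weak_deriv_weak_deriv)

text \<open>
  The representative chosen as the weak derivative agrees almost everywhere with the one that is
  known to be weakly differentiable.
\<close>

lemma weak_deriv_sobolev_2:
  assumes "f \<in> sobolev 2"
  shows "weak_deriv f \<in> sobolev 1"
proof -
  obtain g h where g: "has_weak_deriv f g" and h: "has_weak_deriv g h"
    using assms by (auto simp: numeral_2_eq_2)
  have weak: "has_weak_deriv f (weak_deriv f)"
    using g by (rule has_weak_deriv_weak_deriv)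
  then have L2: "weak_deriv f \<in> L2" by (simp add: has_weak_deriv_def)
  obtain G where G: "h \<in> L2" "primitive G h" "G 1 = G 0" "AE x in torus. g x = G x"
    by (rule has_weak_derivE[OF h])
  have "AE x in torus. weak_deriv f x = G x"
    using has_weak_deriv_unique[OF weak g] G(4) by eventually_elim simp
  then have "has_weak_deriv (weak_deriv f) h"
    unfolding has_weak_deriv_iff_primitive using G L2 by blast
  then show ?thesis
    using L2 G(1) by auto
qed

lemma dom_A_D:
  assumes "(m, u) \<in> dom_A"
  shows "m \<in> L2" "u \<in> L2" "has_weak_deriv m (weak_deriv m)" "has_weak_deriv u (weak_deriv u)"
    "has_weak_deriv (weak_deriv u) (weak_deriv (weak_deriv u))" "AE x in torus. 0 < m x"
proof -
  have m: "m \<in> sobolev 1" and u: "u \<in> sobolev 2" and inf: "torus_inf m > 0"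
    using assms by (auto simp: dom_A_def)
  have u1: "u \<in> sobolev 1"
    using u by (auto simp: numeral_2_eq_2)
  show "m \<in> L2" "u \<in> L2"
    using m u1 by auto
  show "has_weak_deriv m (weak_deriv m)" "has_weak_deriv u (weak_deriv u)"
    "has_weak_deriv (weak_deriv u) (weak_deriv (weak_deriv u))"
    using m u1 weak_deriv_sobolev_2[OF u] by (simp_all only: sobolev_1_has_weak_deriv)
  have neg: "esssup torus (\<lambda>x. - ereal (m x)) < 0"
    using inf unfolding torus_inf_def by (simp add: ereal_less_uminus_reorder)
  have "AE x in torus. - ereal (m x) \<le> esssup torus (\<lambda>x. - ereal (m x))"
    by (rule esssup_AE)
  then show "AE x in torus. 0 < m x"
  proof eventually_elim
    case (elim x)
    then have "- ereal (m x) < 0" using neg by (rule le_less_trans)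
    then show ?case by simp
  qed
qed

text \<open>
  The second component of \<open>A\<close> is formed with a choice operator, which is meaningful only if the flux
  has a weak derivative. It has one because \<open>m\<close> and \<open>u\<^sub>x + b\<close> both belong to \<open>W\<^sup>1\<^sup>,\<^sup>2\<close>, which is
  closed under products in dimension one.
\<close>

lemma flux_has_weak_deriv:
  assumes "(m, u) \<in> dom_A" and b: "torus_smooth b"
  defines "flux \<equiv> \<lambda>x. m x * (weak_deriv u x + b x)"
  shows "has_weak_deriv flux (weak_deriv flux)"
proof -
  note D = dom_A_D[OF assms(1)]
  have "has_weak_deriv flux (\<lambda>x. m x * (weak_deriv (weak_deriv u) x + deriv b x) + weak_deriv m x * (weak_deriv u x + b x))"
    using has_weak_deriv_mult[OF D(3) has_weak_deriv_add_scale[OF D(5) torus_smooth_has_weak_deriv[OF b], of 1]]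
    by (simp add: flux_def)
  then show ?thesis
    by (rule has_weak_deriv_weak_deriv)
qed

text \<open>
  The pointwise form of the monotonicity of \<open>A\<close>. The Hamiltonian is the quadratic
  \<open>q\<^sup>2 / 2\<close> in the shifted momentum \<open>q = p + b\<close>, up to a term that does not involve \<open>p\<close>, and
  the first two summands equal \<open>- (q - q')\<^sup>2 (m + m') / 2\<close>. The third is nonpositive because the logarithm
  is increasing.
\<close>

lemma monotone_integrand:
  fixes m m' p p' b :: real
  assumes m: "0 < m" "0 < m'"
  shows "- (p - p') * (m * (p + b) - m' * (p' + b))
    + (m - m') * ((p\<^sup>2 / 2 + b * p) - (p'\<^sup>2 / 2 + b * p')) - (m - m') * (ln m - ln m') \<le> 0"
proof -
  have "- (p - p') * (m * (p + b) - m' * (p' + b)) + (m - m') * ((p\<^sup>2 / 2 + b * p) - (p'\<^sup>2 / 2 + b * p'))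
    = - ((p - p')\<^sup>2 * (m + m') / 2)"
    by (simp add: field_simps power2_eq_square)
  moreover have "0 \<le> (p - p')\<^sup>2 * (m + m') / 2"
    using m by simp
  moreover have "0 \<le> (m - m') * (ln m - ln m')"
    using m by (cases "m \<le> m'") (auto intro: mult_nonneg_nonneg mult_nonpos_nonpos)
  ultimately show ?thesis by linarith
qed

lemma flow_solution_mass:
  assumes "flow_solution V b H m u" and t: "0 \<le> t"
  shows "(\<integral>x. m t x \<partial>torus) = (\<integral>x. m 0 x \<partial>torus)"
proof -
  have "\<exists>c. \<forall>s\<in>{0..}. (\<integral>x. m s x \<partial>torus) = c"
    using assms(1) unfolding flow_solution_def
    by (intro has_field_derivative_zero_constant) auto
  then show ?thesis
    using t by auto
qed

theorem mainTheorem1: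
  fixes V b H H' :: "real \<Rightarrow> real" and m u m' u' :: "real \<Rightarrow> real \<Rightarrow> real"
  assumes "torus_smooth V" and "torus_smooth b"
    and "flow_solution V b H m u"
    and "flow_solution V b H' m' u'"
    and "(\<integral>x. m 0 x \<partial>torus) = 1"
    and "(\<integral>x. m' 0 x \<partial>torus) = 1"
  shows "\<forall>t\<ge>0. \<exists>D\<le>0.
    ((\<lambda>s. (L2_norm (\<lambda>x. u s x - u' s x))\<^sup>2 + (L2_norm (\<lambda>x. m s x - m' s x))\<^sup>2)
      has_real_derivative D) (at t within {0..})"
proof (intro allI impI)
  fix t :: real assume t: "0 \<le> t"
  have dom: "\<forall>s\<ge>0. (m s, u s) \<in> dom_A" "\<forall>s\<ge>0. (m' s, u' s) \<in> dom_A"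
    using assms(3,4) by (auto simp: flow_solution_def)
  then have L2: "\<forall>s\<ge>0. m s \<in> L2" "\<forall>s\<ge>0. m' s \<in> L2" "\<forall>s\<ge>0. u s \<in> L2" "\<forall>s\<ge>0. u' s \<in> L2"
    by (auto dest: dom_A_D)
  define p p' where "p = weak_deriv (u t)" and "p' = weak_deriv (u' t)"
  define F F' where "F x = m t x * (p x + b x)" and "F' x = m' t x * (p' x + b x)" for x
  obtain dm du where d: "has_L2_deriv m dm t" "has_L2_deriv u du t"
      "AE x in torus. dm x = - fst (op_A V b (m t, u t)) x + H t"
      "AE x in torus. du x = - snd (op_A V b (m t, u t)) x"
    using assms(3) t unfolding flow_solution_def by blast
  obtain dm' du' where d': "has_L2_deriv m' dm' t" "has_L2_deriv u' du' t"
      "AE x in torus. dm' x = - fst (op_A V b (m' t, u' t)) x + H' t"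
      "AE x in torus. du' x = - snd (op_A V b (m' t, u' t)) x"
    using assms(4) t unfolding flow_solution_def by blast
  define \<mu> \<omega> where "\<mu> x = m t x - m' t x" and "\<omega> x = u t x - u' t x" for x
  define d\<mu> d\<omega> where "d\<mu> x = dm x - dm' x" and "d\<omega> x = du x - du' x" for x
  have dL2: "d\<mu> \<in> L2" "d\<omega> \<in> L2"
    using d d' unfolding d\<mu>_def[abs_def] d\<omega>_def[abs_def] by (auto simp: has_L2_deriv_def intro: L2_diff)
  have \<mu>: "\<mu> \<in> L2" and \<omega>: "\<omega> \<in> L2"
    using L2 t unfolding \<mu>_def[abs_def] \<omega>_def[abs_def] by (auto intro: L2_diff)

  let ?D = "2 * (\<integral>x. \<omega> x * d\<omega> x \<partial>torus) + 2 * (\<integral>x. \<mu> x * d\<mu> x \<partial>torus)"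
  have "((\<lambda>s. (L2_norm (\<lambda>x. u s x - u' s x))\<^sup>2 + (L2_norm (\<lambda>x. m s x - m' s x))\<^sup>2)
      has_real_derivative ?D) (at t within {0..})"
    unfolding \<mu>_def \<omega>_def d\<mu>_def d\<omega>_def using L2 t
    by (intro DERIV_add L2_norm_sq_has_real_derivative has_L2_deriv_diff d d' t) (auto intro: L2_diff)
  moreover have "?D \<le> 0"
  proof -
    \<comment> \<open>The continuity equation is integrated by parts against \<open>\<omega>\<close>.\<close>
    have F: "has_weak_deriv F (weak_deriv F)" "has_weak_deriv F' (weak_deriv F')"
      using flux_has_weak_deriv[OF _ assms(2)] dom t by (auto simp: F_def[abs_def] F'_def[abs_def] p_def p'_def)
    then have F_L2: "F \<in> L2" "F' \<in> L2"
      by (auto simp: has_weak_deriv_def)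
    have flux: "has_weak_deriv (\<lambda>x. F x + (- 1) * F' x) (\<lambda>x. weak_deriv F x + (- 1) * weak_deriv F' x)"
      by (rule has_weak_deriv_add_scale[OF F])
    have momentum: "has_weak_deriv \<omega> (\<lambda>x. p x + (- 1) * p' x)"
      using has_weak_deriv_add_scale[OF dom_A_D(4) dom_A_D(4), of "m t" "u t" "m' t" "u' t" "- 1"] dom t
      by (simp add: \<omega>_def[abs_def] p_def p'_def)
    then have p_L2: "(\<lambda>x. p x - p' x) \<in> L2"
      by (simp add: has_weak_deriv_def)
    have "AE x in torus. d\<omega> x = weak_deriv F x + (- 1) * weak_deriv F' x"
      using d(4) d'(4)
      by eventually_elim (simp add: d\<omega>_def op_A_def F_def[abs_def] F'_def[abs_def] p_def p'_def)
    then have "(\<integral>x. \<omega> x * d\<omega> x \<partial>torus) = (\<integral>x. \<omega> x * (weak_deriv F x + (- 1) * weak_deriv F' x) \<partial>torus)"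
      using flux \<omega> dL2 L2_measurable
      by (intro integral_cong_AE borel_measurable_times) (auto simp: has_weak_deriv_def elim!: eventually_mono)
    also have "\<dots> = - (\<integral>x. (p x - p' x) * (F x - F' x) \<partial>torus)"
      using has_weak_deriv_by_parts[OF momentum flux] by simp
    finally have \<omega>_eq: "(\<integral>x. \<omega> x * d\<omega> x \<partial>torus) = - (\<integral>x. (p x - p' x) * (F x - F' x) \<partial>torus)" .

    \<comment> \<open>Both masses are \<open>1\<close>, so the constants \<open>H t\<close> and \<open>H' t\<close> are orthogonal to \<open>\<mu>\<close> and may be subtracted.\<close>
    have "(\<integral>x. \<mu> x \<partial>torus) = 0"
      using flow_solution_mass[OF assms(3) t] flow_solution_mass[OF assms(4) t] assms(5,6) L2 t
      by (simp add: \<mu>_def L2_integrable)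
    then have "(\<integral>x. \<omega> x * d\<omega> x \<partial>torus) + (\<integral>x. \<mu> x * d\<mu> x \<partial>torus)
      = (\<integral>x. - ((p x - p' x) * (F x - F' x)) + \<mu> x * d\<mu> x - (H t - H' t) * \<mu> x \<partial>torus)"
      using L2_integrable_mult[OF p_L2 L2_diff[OF F_L2]] L2_integrable_mult[OF \<mu> dL2(1)] L2_integrable[OF \<mu>]
      by (simp add: \<omega>_eq)
    also have "\<dots> \<le> (\<integral>x. 0 \<partial>torus)"
    proof (rule integral_mono_AE)
      show "integrable torus (\<lambda>x. - ((p x - p' x) * (F x - F' x)) + \<mu> x * d\<mu> x - (H t - H' t) * \<mu> x)"
        using L2_integrable_mult[OF p_L2 L2_diff[OF F_L2]] L2_integrable_mult[OF \<mu> dL2(1)] L2_integrable[OF \<mu>]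
        by simp
      have "AE x in torus. 0 < m t x" "AE x in torus. 0 < m' t x"
        using dom t by (auto intro: dom_A_D)
      then show "AE x in torus. - ((p x - p' x) * (F x - F' x)) + \<mu> x * d\<mu> x - (H t - H' t) * \<mu> x \<le> 0"
        using d(3) d'(3)
      proof eventually_elim
        case (elim x)
        have "d\<mu> x = ((p x)\<^sup>2 / 2 + b x * p x) - ((p' x)\<^sup>2 / 2 + b x * p' x)
            - (ln (m t x) - ln (m' t x)) + (H t - H' t)"
          using elim by (simp add: d\<mu>_def op_A_def p_def p'_def)
        then have "\<mu> x * d\<mu> x - (H t - H' t) * \<mu> x
          = \<mu> x * (((p x)\<^sup>2 / 2 + b x * p x) - ((p' x)\<^sup>2 / 2 + b x * p' x))
            - \<mu> x * (ln (m t x) - ln (m' t x))"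
          by (simp only:) (simp only: ring_distribs mult.commute)
        then show ?case
          using monotone_integrand[OF elim(1,2), of "p x" "p' x" "b x"]
          unfolding F_def F'_def \<mu>_def mult_minus_left by linarith
      qed
    qed simp
    finally show ?thesis by simp
  qed
  ultimately show "\<exists>D\<le>0. ((\<lambda>s. (L2_norm (\<lambda>x. u s x - u' s x))\<^sup>2 + (L2_norm (\<lambda>x. m s x - m' s x))\<^sup>2)
      has_real_derivative D) (at t within {0..})"
    by blast
qed

end
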